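(* Let $\psi:[0,1]\to[0,\infty)$ be a non-negative, measurable function and let $\omega_1$ and $\omega_2$ be positive, continuous functions on $\mathbb{R}^+=[0,\infty)$. Assume that there exists a constant $C$ such that $$\int_0^1\omega_2(s/t)\,\frac{\psi(t)}{t}\,dt\le C\,\omega_1(s)\qquad\text{for every } s\in\mathbb{R}^+,$$ so that $U_\psi:L^1(\omega_1)\to L^1(\omega_2)$ is a bounded operator. If $\psi\neq0$ (that is, $\psi$ is not almost everywhere equal to $0$), then $U_\psi$ is not weakly compact.
   Context: $\mathbb{R}^+=[0,\infty)$ with Lebesgue measure. For a positive, continuous function $\omega$ on $\mathbb{R}^+$, $L^1(\omega)$ is the Banach space of (equivalence classes of) complex-valued measurable functions $f$ on $\mathbb{R}^+$ with $\|f\|_{L^1(\omega)}=\int_0^\infty|f(t)|\omega(t)\,dt<\infty$. For a non-negative, measurable function $\psi$ on $[0,1]$, the generalized Hardy-Cesàro operator is $$(U_\psi f)(x)=\int_0^1 f(tx)\psi(t)\,dt=\frac1x\int_0^x f(s)\psi(s/x)\,ds .$$ Under the displayed integral condition on $\psi,\omega_1,\omega_2$, the integral $(U_\psi f)(x)$ is defined for almost all $x$ for each $f\in L^1(\omega_1)$, and $U_\psi$ is a bounded linear operator from $L^1(\omega_1)$ to $L^1(\omega_2)$. A bounded operator between Banach spaces is weakly compact if it maps the closed unit ball to a relatively weakly compact set. *)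

theory Defs
  imports "HOL-Analysis.Analysis"
begin

text \<open>
  The spaces $L^1(\omega)$ depend on the weight, a term, so complex normed spaces are
  represented by explicit carriers instead of a type class.
\<close>

record 'a cnormed_space =
  vcarrier :: "'a set"
  vadd :: "'a \<Rightarrow> 'a \<Rightarrow> 'a"
  vscale :: "complex \<Rightarrow> 'a \<Rightarrow> 'a"
  vnorm :: "'a \<Rightarrow> real"

definition complex_space :: "complex cnormed_space" where
  "complex_space = \<lparr>vcarrier = UNIV, vadd = (+), vscale = (*), vnorm = cmod\<rparr>"

definition bounded_operator ::
  "'a cnormed_space \<Rightarrow> 'b cnormed_space \<Rightarrow> ('a \<Rightarrow> 'b) \<Rightarrow> bool" where
  "bounded_operator X Y T \<longleftrightarrow>
     (\<forall>u\<in>vcarrier X. T u \<in> vcarrier Y) \<and>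
     (\<forall>u\<in>vcarrier X. \<forall>v\<in>vcarrier X. T (vadd X u v) = vadd Y (T u) (T v)) \<and>
     (\<forall>c. \<forall>u\<in>vcarrier X. T (vscale X c u) = vscale Y c (T u)) \<and>
     (\<exists>K. \<forall>u\<in>vcarrier X. vnorm Y (T u) \<le> K * vnorm X u)"

definition weak_topology :: "'a cnormed_space \<Rightarrow> 'a topology" where
  "weak_topology X = topology_generated_by
     {{u \<in> vcarrier X. \<phi> u \<in> V} |\<phi> V. bounded_operator X complex_space \<phi> \<and> open V}"

definition unit_cball :: "'a cnormed_space \<Rightarrow> 'a set" where
  "unit_cball X = {u \<in> vcarrier X. vnorm X u \<le> 1}"

definition weakly_compact_operator ::
  "'a cnormed_space \<Rightarrow> 'b cnormed_space \<Rightarrow> ('a \<Rightarrow> 'b) \<Rightarrow> bool" where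
  "weakly_compact_operator X Y T \<longleftrightarrow>
     bounded_operator X Y T \<and>
     compactin (weak_topology Y) (weak_topology Y closure_of (T ` unit_cball X))"

text \<open>
  Functions on $[0,\infty)$ are represented by functions on the reals whose values at
  negative arguments are ignored: they are unconstrained within an equivalence class.
\<close>

definition L1_fun :: "(real \<Rightarrow> real) \<Rightarrow> (real \<Rightarrow> complex) set" where
  "L1_fun \<omega> = {f. f \<in> borel_measurable (lebesgue_on {0..}) \<and>
                  integrable (lebesgue_on {0..}) (\<lambda>t. cmod (f t) * \<omega> t)}"

definition L1_class :: "(real \<Rightarrow> real) \<Rightarrow> (real \<Rightarrow> complex) \<Rightarrow> (real \<Rightarrow> complex) set" where
  "L1_class \<omega> f = {g \<in> L1_fun \<omega>. AE t in lebesgue_on {0..}. g t = f t}"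

text \<open>
  The operations on classes collect the results over all representatives; since these results
  are all almost everywhere equal, each union is a union of copies of a single class, and the
  set of norms is a singleton.
\<close>

definition L1 :: "(real \<Rightarrow> real) \<Rightarrow> (real \<Rightarrow> complex) set cnormed_space" where
  "L1 \<omega> = \<lparr>
     vcarrier = L1_class \<omega> ` L1_fun \<omega>,
     vadd = (\<lambda>F G. \<Union>f\<in>F. \<Union>g\<in>G. L1_class \<omega> (\<lambda>t. f t + g t)),
     vscale = (\<lambda>c F. \<Union>f\<in>F. L1_class \<omega> (\<lambda>t. c * f t)),
     vnorm = (\<lambda>F. the_elem ((\<lambda>f. LINT t|lebesgue_on {0..}. cmod (f t) * \<omega> t) ` F))\<rparr>"

definition hardy_cesaro :: "(real \<Rightarrow> real) \<Rightarrow> (real \<Rightarrow> complex) \<Rightarrow> real \<Rightarrow> complex" where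
  "hardy_cesaro \<psi> f x = (LINT t|lebesgue_on {0..1}. f (t * x) * complex_of_real (\<psi> t))"

text \<open>
  The operator induced on classes. If \<open>f\<close> and \<open>g\<close> agree almost everywhere on $[0,\infty)$, then
  \<open>hardy_cesaro \<psi> f\<close> and \<open>hardy_cesaro \<psi> g\<close> agree at every positive point, so that the choice of
  the representative is again immaterial.
\<close>

definition hardy_cesaro_op ::
  "(real \<Rightarrow> real) \<Rightarrow> (real \<Rightarrow> real) \<Rightarrow> (real \<Rightarrow> complex) set \<Rightarrow> (real \<Rightarrow> complex) set" where
  "hardy_cesaro_op \<psi> \<omega>2 F = (\<Union>f\<in>F. L1_class \<omega>2 (hardy_cesaro \<psi> f))"

end

theory Submission
  imports Defs
begin

text \<open>
  Boundedness is Tonelli's theorem. Substituting \<open>x = s / t\<close> in the iterated integral of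
  \<open>\<bar>f (t * x)\<bar> * \<psi> t * \<omega>2 x\<close> over \<open>t\<close> and \<open>x\<close> (\<open>nn_integral_dilates_swap\<close>) turns it into the integral
  of \<open>\<bar>f s\<bar>\<close> against the left-hand side of the integral condition on the weights, so that it is at
  most a constant times the norm of \<open>f\<close>. This gives at once the convergence of the defining
  integral for almost every \<open>x\<close> and the norm estimate (\<open>hardy_cesaro_regularity\<close>).

  Weak compactness fails because the operator commutes with dilations and therefore concentrates
  mass at the origin. Let \<open>f\<^sub>n\<close> be a constant multiple of the uniform density on \<open>{0..1 / n}\<close>; as
  \<open>\<omega>1\<close> is bounded near the origin, the \<open>f\<^sub>n\<close> can be taken in the unit ball. On \<open>{0..1 / n}\<close> the image
  of \<open>f\<^sub>n\<close> is a constant multiple of \<open>n\<close> times the integral of \<open>\<psi>\<close>, which is positive since \<open>\<psi>\<close> is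
  not null (\<open>bump_profile_near_0\<close>); hence the images keep a fixed positive mass on the unit
  interval. On the other hand, the integral condition at \<open>s = 0\<close> says that \<open>\<psi> t / t\<close> is integrable,
  and this forces the images to tend to zero uniformly on \<open>{a..1}\<close> for every positive \<open>a\<close>
  (\<open>bump_profile_away_from_0\<close>, \<open>tail_tendsto_0\<close>). Integration over \<open>{a..1}\<close> is a bounded functional,
  so a weak cluster point of the images would have integral zero over each \<open>{a..1}\<close> and, by
  dominated convergence as \<open>a\<close> decreases to zero, over the whole unit interval, contradicting the
  fixed mass. The lemma \<open>not_weakly_compact_if_mass_escapes\<close> is the abstract form of this
  contradiction.
\<close>

section \<open>Null sets, Borel representatives and Tonelli's theorem\<close>

lemma AE_lebesgue_on_iff:
  "S \<in> sets lebesgue \<Longrightarrow> (AE x in lebesgue_on S. P x) \<longleftrightarrow> (AE x in lborel. x \<in> S \<longrightarrow> P x)"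
  by (simp add: AE_restrict_space_iff AE_completion_iff)

lemma nn_integral_lebesgue_on:
  "S \<in> sets lebesgue \<Longrightarrow> nn_integral (lebesgue_on S) f = (\<integral>\<^sup>+x. f x * indicator S x \<partial>lborel)"
  by (simp add: nn_integral_restrict_space nn_integral_completion)

lemma unit_interval_lebesgue: "{0..1 :: real} \<in> sets lebesgue"
  and half_line_lebesgue: "{0 :: real..} \<in> sets lebesgue"
  and unit_interval_subset: "{0..1 :: real} \<subseteq> {0..}"
  by auto

lemma AE_lebesgue_on_pos:
  assumes "S \<in> sets lebesgue" and "S \<subseteq> {0 :: real..}"
  shows "AE x in lebesgue_on S. 0 < x"
proof -
  have "AE x in lborel. x \<in> S \<longrightarrow> 0 < x"
    using AE_lborel_singleton[of "0 :: real"] by eventually_elim (use assms(2) in force)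
  then show ?thesis by (simp add: AE_lebesgue_on_iff assms(1))
qed

text \<open>
  Dilations by a positive factor preserve null sets. Hence for positive \<open>x\<close> the factor
  \<open>f (t * x)\<close> of the integrand in the Hardy-Cesaro operator depends, up to a null set of \<open>t\<close>, only on the
  class of \<open>f\<close>.
\<close>

lemma AE_dilation:
  fixes P :: "real \<Rightarrow> bool"
  assumes "AE y in lebesgue_on {0..}. P y" and "0 < x"
  shows "AE t in lebesgue_on {0..1}. P (t * x)"
proof -
  have "AE y in lborel. y \<in> {0..} \<longrightarrow> P y"
    using assms(1) by (simp add: AE_lebesgue_on_iff)
  then obtain N where N: "{y \<in> space lborel. \<not> (y \<in> {0..} \<longrightarrow> P y)} \<subseteq> N" "N \<in> null_sets lborel"
    unfolding eventually_ae_filter by blast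
  have [measurable]: "N \<in> sets borel" using N(2) by auto
  have "AE t in lborel. 0 + x * t \<notin> N"
    by (rule AE_borel_affine) (use \<open>0 < x\<close> N(2) AE_not_in in auto)
  then have "AE t in lborel. t \<in> {0..1} \<longrightarrow> P (t * x)"
  proof (rule AE_mp, intro AE_I2 impI)
    fix t assume "0 + x * t \<notin> N" "t \<in> {0..1}"
    moreover have "0 \<le> t * x" using \<open>0 < x\<close> \<open>t \<in> {0..1}\<close> by simp
    ultimately show "P (t * x)" using N(1) by (auto simp: mult.commute)
  qed
  then show ?thesis by (simp add: AE_lebesgue_on_iff)
qed

text \<open>
  For a Lebesgue measurable \<open>f\<close>, the function \<open>(t, x) \<mapsto> f (t * x)\<close> need not be measurable for the
  product of the two Borel measures, so that Tonelli's theorem is applied to Borel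
  representatives.
\<close>

lemma borel_representative_real:
  fixes f :: "real \<Rightarrow> real"
  assumes "f \<in> borel_measurable (lebesgue_on S)" and S: "S \<in> sets lebesgue"
  obtains g where "g \<in> borel_measurable borel" "AE x in lebesgue_on S. g x = f x"
proof -
  have "(\<lambda>x. if x \<in> S then f x else 0) \<in> borel_measurable lebesgue"
    using assms by (simp add: borel_measurable_if)
  then obtain g where "g \<in> borel_measurable lborel"
    "AE x in lborel. (if x \<in> S then f x else 0) = g x"
    using completion_ex_borel_measurable_real by blast
  then show thesis
    by (intro that[of g]) (auto simp: AE_lebesgue_on_iff S elim!: AE_mp)
qed

lemma borel_representative_complex:
  fixes f :: "real \<Rightarrow> complex"
  assumes f: "f \<in> borel_measurable (lebesgue_on S)" and S: "S \<in> sets lebesgue"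
  obtains g where "g \<in> borel_measurable borel" "AE x in lebesgue_on S. g x = f x"
proof -
  have "(\<lambda>x. Re (f x)) \<in> borel_measurable (lebesgue_on S)"
    "(\<lambda>x. Im (f x)) \<in> borel_measurable (lebesgue_on S)"
    using f by measurable
  then obtain g h where g: "g \<in> borel_measurable borel" "AE x in lebesgue_on S. g x = Re (f x)"
    and h: "h \<in> borel_measurable borel" "AE x in lebesgue_on S. h x = Im (f x)"
    using S by (metis borel_representative_real)
  have "AE x in lebesgue_on S. Complex (g x) (h x) = f x"
    using g(2) h(2) by eventually_elim simp
  moreover have "(\<lambda>x. Complex (g x) (h x)) \<in> borel_measurable borel"
    unfolding Complex_eq using g(1) h(1) by measurable
  ultimately show thesis by (rule that[rotated])
qed

text \<open>
  The identity behind the boundedness of the operator: by Tonelli's theorem the weight is moved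
  from \<open>x\<close> onto \<open>s = t * x\<close>, and the substitution \<open>x = s / t\<close> produces the factor \<open>1 / t\<close> that
  appears in the integral condition on the two weights.
\<close>

lemma nn_integral_dilates_swap:
  fixes g p w :: "real \<Rightarrow> ennreal"
  assumes [measurable]: "g \<in> borel_measurable borel" "p \<in> borel_measurable borel"
    "w \<in> borel_measurable borel"
    and p0: "\<And>t. t \<le> 0 \<Longrightarrow> p t = 0"
  shows "(\<integral>\<^sup>+x. (\<integral>\<^sup>+t. g (t * x) * p t \<partial>lborel) * w x \<partial>lborel) =
    (\<integral>\<^sup>+s. g s * (\<integral>\<^sup>+t. w (s / t) * (p t * ennreal (1 / t)) \<partial>lborel) \<partial>lborel)"
proof -
  have subst: "(\<integral>\<^sup>+x. g (t * x) * w x \<partial>lborel) * p t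
      = (\<integral>\<^sup>+s. g s * (w (s / t) * (p t * ennreal (1 / t))) \<partial>lborel)" for t
  proof (cases "t \<le> 0")
    case True
    then show ?thesis by (simp add: p0)
  next
    case False
    have "(\<integral>\<^sup>+x. g (t * x) * w x \<partial>lborel) = ennreal (1 / t) * (\<integral>\<^sup>+s. g s * w (s / t) \<partial>lborel)"
      using False
      by (subst nn_integral_real_affine[where c = "1 / t" and t = 0]) (auto simp: mult.commute)
    then show ?thesis
      by (simp add: nn_integral_cmult[symmetric] nn_integral_multc[symmetric] mult_ac)
  qed
  have "(\<integral>\<^sup>+x. (\<integral>\<^sup>+t. g (t * x) * p t \<partial>lborel) * w x \<partial>lborel)
      = (\<integral>\<^sup>+x. (\<integral>\<^sup>+t. g (t * x) * w x * p t \<partial>lborel) \<partial>lborel)"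
    by (subst nn_integral_multc[symmetric]) (auto simp: mult_ac)
  also have "\<dots> = (\<integral>\<^sup>+t. (\<integral>\<^sup>+x. g (t * x) * w x * p t \<partial>lborel) \<partial>lborel)"
    by (rule lborel_pair.Fubini') measurable
  also have "\<dots> = (\<integral>\<^sup>+t. (\<integral>\<^sup>+s. g s * (w (s / t) * (p t * ennreal (1 / t))) \<partial>lborel) \<partial>lborel)"
    by (simp add: nn_integral_multc subst)
  also have "\<dots> = (\<integral>\<^sup>+s. (\<integral>\<^sup>+t. g s * (w (s / t) * (p t * ennreal (1 / t))) \<partial>lborel) \<partial>lborel)"
    by (rule lborel_pair.Fubini') measurable
  also have "\<dots> = (\<integral>\<^sup>+s. g s * (\<integral>\<^sup>+t. w (s / t) * (p t * ennreal (1 / t)) \<partial>lborel) \<partial>lborel)"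
    by (simp add: nn_integral_cmult)
  finally show ?thesis .
qed

lemma borel_measurable_dilation:
  fixes f :: "real \<Rightarrow> complex"
  assumes "f \<in> borel_measurable (lebesgue_on {0..})" and "0 \<le> x"
  shows "(\<lambda>t. f (t * x)) \<in> borel_measurable (lebesgue_on {0..1})"
proof -
  have [measurable]: "(\<lambda>y. if y \<in> {0..} then f y else 0) \<in> borel_measurable lebesgue"
    using assms(1) by (subst borel_measurable_if) auto
  have "(\<lambda>t. if x *\<^sub>R t \<in> {0..} then f (x *\<^sub>R t) else 0) \<in> borel_measurable lebesgue"
    by measurable
  then have "(\<lambda>t. if x *\<^sub>R t \<in> {0..} then f (x *\<^sub>R t) else 0)
      \<in> borel_measurable (lebesgue_on {0..1})"
    by (rule measurable_restrict_space1)
  then show ?thesis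
    by (rule measurable_cong[THEN iffD1, rotated])
      (use \<open>0 \<le> x\<close> in \<open>auto simp: mult.commute\<close>)
qed

section \<open>The weighted spaces as spaces of classes\<close>

locale weight =
  fixes w :: "real \<Rightarrow> real"
  assumes cont: "continuous_on {0..} w" and pos: "0 \<le> x \<Longrightarrow> 0 < w x"
begin

lemma measurable_weight [measurable]: "w \<in> borel_measurable (lebesgue_on {0..})"
  using cont by (simp add: continuous_imp_measurable_on_sets_lebesgue)

lemma L1_fun_measurable: "f \<in> L1_fun w \<Longrightarrow> f \<in> borel_measurable (lebesgue_on {0..})"
  and L1_fun_integrable:
    "f \<in> L1_fun w \<Longrightarrow> integrable (lebesgue_on {0..}) (\<lambda>t. cmod (f t) * w t)"
  by (auto simp: L1_fun_def)

lemma L1_funI_nn_integral: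
  assumes [measurable]: "f \<in> borel_measurable (lebesgue_on {0..})"
    and fin: "(\<integral>\<^sup>+t. ennreal (cmod (f t) * w t) \<partial>lebesgue_on {0..}) < \<infinity>"
  shows "f \<in> L1_fun w"
  unfolding L1_fun_def
proof (intro CollectI conjI)
  show "integrable (lebesgue_on {0..}) (\<lambda>t. cmod (f t) * w t)"
    by (rule integrableI_nonneg) (use fin pos in \<open>auto intro!: AE_I2 simp: less_imp_le\<close>)
qed simp

lemma L1_fun_add:
  assumes "f \<in> L1_fun w" "g \<in> L1_fun w"
  shows "(\<lambda>t. f t + g t) \<in> L1_fun w"
proof -
  note [measurable] = assms[THEN L1_fun_measurable]
  have "integrable (lebesgue_on {0..}) (\<lambda>t. cmod (f t + g t) * w t)"
  proof (rule Bochner_Integration.integrable_bound)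
    show "integrable (lebesgue_on {0..}) (\<lambda>t. cmod (f t) * w t + cmod (g t) * w t)"
      using assms[THEN L1_fun_integrable] by simp
    show "AE t in lebesgue_on {0..}. norm (cmod (f t + g t) * w t)
        \<le> norm (cmod (f t) * w t + cmod (g t) * w t)"
    proof (rule AE_I2)
      fix t :: real assume "t \<in> space (lebesgue_on {0..})"
      then have "0 < w t" using pos by simp
      then show "norm (cmod (f t + g t) * w t) \<le> norm (cmod (f t) * w t + cmod (g t) * w t)"
        using mult_right_mono[OF norm_triangle_ineq[of "f t" "g t"], of "w t"]
        by (simp add: distrib_right abs_of_nonneg)
    qed
  qed measurable
  then show ?thesis by (simp add: L1_fun_def)
qed

lemma L1_fun_scale:
  assumes "f \<in> L1_fun w"
  shows "(\<lambda>t. c * f t) \<in> L1_fun w"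
  using assms by (auto simp: L1_fun_def norm_mult mult.assoc)

text \<open>
  The operations on classes are unions over all representatives; the lemmas below evaluate them
  on any one representative, because all members of such a union are the same class.
\<close>

lemma mem_L1_class: "f \<in> L1_fun w \<Longrightarrow> f \<in> L1_class w f"
  by (simp add: L1_class_def)

lemma L1_class_cong_AE:
  assumes "AE t in lebesgue_on {0..}. f t = g t"
  shows "L1_class w f = L1_class w g"
proof -
  have "(AE t in lebesgue_on {0..}. h t = f t) \<longleftrightarrow> (AE t in lebesgue_on {0..}. h t = g t)" for h
  proof
    assume "AE t in lebesgue_on {0..}. h t = f t"
    then show "AE t in lebesgue_on {0..}. h t = g t" using assms by eventually_elim simp
  next
    assume "AE t in lebesgue_on {0..}. h t = g t"
    then show "AE t in lebesgue_on {0..}. h t = f t" using assms by eventually_elim simp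
  qed
  then show ?thesis by (auto simp: L1_class_def)
qed

lemma carrier_L1: "vcarrier (L1 w) = L1_class w ` L1_fun w"
  by (simp add: L1_def)

lemma vadd_L1:
  assumes "f \<in> L1_fun w" "g \<in> L1_fun w"
  shows "vadd (L1 w) (L1_class w f) (L1_class w g) = L1_class w (\<lambda>t. f t + g t)"
proof -
  have "L1_class w (\<lambda>t. f' t + g' t) = L1_class w (\<lambda>t. f t + g t)"
    if "f' \<in> L1_class w f" "g' \<in> L1_class w g" for f' g'
  proof (rule L1_class_cong_AE)
    have "AE t in lebesgue_on {0..}. f' t = f t" "AE t in lebesgue_on {0..}. g' t = g t"
      using that by (auto simp: L1_class_def)
    then show "AE t in lebesgue_on {0..}. f' t + g' t = f t + g t" by eventually_elim simp
  qed
  moreover have "L1_class w f \<noteq> {}" "L1_class w g \<noteq> {}"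
    using assms mem_L1_class by blast+
  ultimately show ?thesis
    unfolding L1_def cnormed_space.simps by (intro SUP_eq_const)
qed

lemma vscale_L1:
  assumes "f \<in> L1_fun w"
  shows "vscale (L1 w) c (L1_class w f) = L1_class w (\<lambda>t. c * f t)"
proof -
  have "L1_class w (\<lambda>t. c * f' t) = L1_class w (\<lambda>t. c * f t)" if "f' \<in> L1_class w f" for f'
  proof (rule L1_class_cong_AE)
    have "AE t in lebesgue_on {0..}. f' t = f t" using that by (auto simp: L1_class_def)
    then show "AE t in lebesgue_on {0..}. c * f' t = c * f t" by eventually_elim simp
  qed
  moreover have "L1_class w f \<noteq> {}"
    using assms mem_L1_class by blast
  ultimately show ?thesis
    unfolding L1_def cnormed_space.simps by (intro SUP_eq_const)
qed

lemma vnorm_L1: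
  assumes "f \<in> L1_fun w"
  shows "vnorm (L1 w) (L1_class w f) = (LINT t|lebesgue_on {0..}. cmod (f t) * w t)"
proof -
  have "(LINT t|lebesgue_on {0..}. cmod (f' t) * w t) = (LINT t|lebesgue_on {0..}. cmod (f t) * w t)"
    if "f' \<in> L1_class w f" for f'
  proof (rule integral_cong_AE)
    show "(\<lambda>t. cmod (f' t) * w t) \<in> borel_measurable (lebesgue_on {0..})"
      "(\<lambda>t. cmod (f t) * w t) \<in> borel_measurable (lebesgue_on {0..})"
      using that assms by (auto simp: L1_class_def L1_fun_def)
    have "AE t in lebesgue_on {0..}. f' t = f t" using that by (auto simp: L1_class_def)
    then show "AE t in lebesgue_on {0..}. cmod (f' t) * w t = cmod (f t) * w t"
      by eventually_elim simp
  qed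
  moreover have "L1_class w f \<noteq> {}"
    using assms mem_L1_class by blast
  ultimately show ?thesis
    unfolding L1_def cnormed_space.simps by (intro the_elem_image_unique)
qed

end

section \<open>Boundedness of the operator\<close>

locale hardy_cesaro_bound = w1: weight \<omega>1 + w2: weight \<omega>2 for \<omega>1 \<omega>2 :: "real \<Rightarrow> real" +
  fixes \<psi> :: "real \<Rightarrow> real" and K :: real
  assumes psi_meas [measurable]: "\<psi> \<in> borel_measurable (lebesgue_on {0..1})"
    and psi_nonneg: "t \<in> {0..1} \<Longrightarrow> 0 \<le> \<psi> t"
    and K_nonneg: "0 \<le> K"
    and bound: "0 \<le> s \<Longrightarrow>
      (\<integral>\<^sup>+t. ennreal (\<omega>2 (s / t) * (\<psi> t / t)) \<partial>lebesgue_on {0..1}) \<le> ennreal (K * \<omega>1 s)"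
begin

text \<open>
  All three facts come from one finite iterated integral. With \<open>g\<close> and \<open>p\<close> Borel representatives
  of \<open>f\<close> and \<open>\<psi>\<close>, the integral of \<open>\<bar>g (t * x)\<bar> * p t * \<omega>2 x\<close> over \<open>t\<close> and \<open>x\<close> is at most \<open>K\<close> times
  the norm of \<open>f\<close>, by the integral condition. Since \<open>\<omega>2\<close> is positive, the inner integral over \<open>t\<close> is then finite
  for almost every \<open>x\<close>, and it dominates the absolute value of the operator.
\<close>

lemma hardy_cesaro_regularity:
  assumes f: "f \<in> L1_fun \<omega>1"
  shows hardy_cesaro_integrable:
      "AE x in lebesgue_on {0..}. integrable (lebesgue_on {0..1}) (\<lambda>t. f (t * x) * complex_of_real (\<psi> t))"
    and hardy_cesaro_L1_fun: "hardy_cesaro \<psi> f \<in> L1_fun \<omega>2"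
    and hardy_cesaro_norm_le: "(LINT x|lebesgue_on {0..}. cmod (hardy_cesaro \<psi> f x) * \<omega>2 x)
      \<le> K * (LINT x|lebesgue_on {0..}. cmod (f x) * \<omega>1 x)"
proof -
  note f_meas [measurable] = w1.L1_fun_measurable[OF f]
  obtain g where g [measurable]: "g \<in> borel_measurable borel"
    and gf: "AE x in lebesgue_on {0..}. g x = f x"
    using borel_representative_complex[OF f_meas] by auto
  obtain p0 where [measurable]: "p0 \<in> borel_measurable borel"
    and p0: "AE t in lebesgue_on {0..1}. p0 t = \<psi> t"
    using borel_representative_real[OF psi_meas] by auto
  \<comment> \<open>Setting \<open>p\<close> to zero off \<open>{0<..1}\<close> turns the integrals over the unit interval into integrals over
    the real line and excludes the meaningless point \<open>t = 0\<close> of \<open>s / t\<close>.\<close>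
  define p where "p t = indicator {0<..1} t * max 0 (p0 t)" for t :: real
  have [measurable]: "p \<in> borel_measurable borel"
    unfolding p_def by measurable
  have p_nonneg: "0 \<le> p t" for t by (simp add: p_def)
  have p_zero: "p t = 0" if "t \<notin> {0<..1}" for t using that by (simp add: p_def)
  have "AE t in lborel. t \<in> {0..1} \<longrightarrow> p t = \<psi> t"
    using p0[unfolded AE_lebesgue_on_iff[OF unit_interval_lebesgue]]
      AE_lborel_singleton[of "0 :: real"]
  proof eventually_elim
    case (elim t)
    then show ?case using psi_nonneg[of t] by (auto simp: p_def)
  qed
  then have p_psi: "AE t in lebesgue_on {0..1}. p t = \<psi> t"
    by (simp add: AE_lebesgue_on_iff)
  define w where "w x = indicator {0..} x * \<omega>2 x" for x :: real
  have w_meas [measurable]: "w \<in> borel_measurable borel"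
    using borel_measurable_continuous_on_indicator[OF _ w2.cont] by (simp add: w_def[abs_def])
  have w_nonneg: "0 \<le> w x" for x using w2.pos[of x] by (auto simp: w_def indicator_def)
  define V where "V x = (LINT t|lborel. g (t * x) * complex_of_real (p t))" for x
  have V_meas [measurable]: "V \<in> borel_measurable borel"
    unfolding V_def by measurable
  have kernel_AE: "AE t in lebesgue_on {0..1}.
      f (t * x) * complex_of_real (\<psi> t) = g (t * x) * complex_of_real (p t)" if "0 < x" for x
    using AE_dilation[OF gf that] p_psi by eventually_elim simp
  have kernel_meas: "(\<lambda>t. f (t * x) * complex_of_real (\<psi> t)) \<in> borel_measurable (lebesgue_on {0..1})"
    "(\<lambda>t. g (t * x) * complex_of_real (p t)) \<in> borel_measurable (lebesgue_on {0..1})"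
    if "0 < x" for x
  proof -
    note [measurable] = borel_measurable_dilation[OF f_meas less_imp_le[OF that]]
    show "(\<lambda>t. f (t * x) * complex_of_real (\<psi> t)) \<in> borel_measurable (lebesgue_on {0..1})"
      by measurable
    show "(\<lambda>t. g (t * x) * complex_of_real (p t)) \<in> borel_measurable (lebesgue_on {0..1})"
      by (intro measurable_restrict_space1 measurable_completion) measurable
  qed
  have restrict: "indicator {0..1} t *\<^sub>R (g (t * x) * complex_of_real (p t))
      = g (t * x) * complex_of_real (p t)" for t x
    using p_zero[of t] by (auto simp: indicator_def)
  have U_eq: "hardy_cesaro \<psi> f x = V x" if "0 < x" for x
  proof -
    have "hardy_cesaro \<psi> f x = (LINT t|lebesgue_on {0..1}. g (t * x) * complex_of_real (p t))"
      unfolding hardy_cesaro_def by (rule integral_cong_AE[OF kernel_meas[OF that] kernel_AE[OF that]])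
    also have "\<dots> = V x"
      unfolding V_def by (subst integral_restrict_space) (auto simp: restrict integral_completion)
    finally show ?thesis .
  qed
  let ?A = "\<lambda>x. \<integral>\<^sup>+t. ennreal (cmod (g (t * x))) * ennreal (p t) \<partial>lborel"
  have inner: "(\<integral>\<^sup>+t. ennreal (w (s / t)) * (ennreal (p t) * ennreal (1 / t)) \<partial>lborel)
      \<le> ennreal (K * \<omega>1 s) * indicator {0..} s" for s
  proof (cases "0 \<le> s")
    case True
    have "(\<integral>\<^sup>+t. ennreal (w (s / t)) * (ennreal (p t) * ennreal (1 / t)) \<partial>lborel)
        = (\<integral>\<^sup>+t. ennreal (\<omega>2 (s / t) * (\<psi> t / t)) * indicator {0..1} t \<partial>lborel)"
    proof (rule nn_integral_cong_AE)
      show "AE t in lborel. ennreal (w (s / t)) * (ennreal (p t) * ennreal (1 / t))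
          = ennreal (\<omega>2 (s / t) * (\<psi> t / t)) * indicator {0..1} t"
        using p_psi[unfolded AE_lebesgue_on_iff[OF unit_interval_lebesgue]]
          AE_lborel_singleton[of "0 :: real"]
      proof eventually_elim
        case (elim t)
        show ?case
        proof (cases "t \<in> {0<..1}")
          case True
          then have "0 \<le> s / t" using \<open>0 \<le> s\<close> by simp
          moreover have "p t = \<psi> t" using elim(1) True by auto
          ultimately show ?thesis using True w2.pos[of "s / t"] p_nonneg[of t]
            by (auto simp: w_def ennreal_mult[symmetric] indicator_def divide_inverse)
        next
          case False
          then show ?thesis using elim(2) p_zero[of t] by (auto simp: indicator_def)
        qed
      qed
    qed
    also have "\<dots> \<le> ennreal (K * \<omega>1 s)"
      using bound[OF True] by (simp add: nn_integral_lebesgue_on)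
    finally show ?thesis using True by simp
  next
    case False
    have zero: "ennreal (w (s / t)) * (ennreal (p t) * ennreal (1 / t)) = 0" for t
    proof (cases "0 < t")
      case True
      then have "w (s / t) = 0" using False by (simp add: w_def indicator_def zero_le_divide_iff)
      then show ?thesis by simp
    next
      case False
      then show ?thesis using p_zero[of t] by simp
    qed
    show ?thesis by (simp only: zero nn_integral_const mult_zero_left zero_le)
  qed
  have norm_f: "(\<integral>\<^sup>+s. ennreal (cmod (g s)) * (ennreal (\<omega>1 s) * indicator {0..} s) \<partial>lborel)
      = ennreal (LINT x|lebesgue_on {0..}. cmod (f x) * \<omega>1 x)"
  proof -
    have "(\<integral>\<^sup>+s. ennreal (cmod (g s)) * (ennreal (\<omega>1 s) * indicator {0..} s) \<partial>lborel)
        = (\<integral>\<^sup>+s. ennreal (cmod (f s) * \<omega>1 s) * indicator {0..} s \<partial>lborel)"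
    proof (rule nn_integral_cong_AE)
      show "AE s in lborel. ennreal (cmod (g s)) * (ennreal (\<omega>1 s) * indicator {0..} s)
          = ennreal (cmod (f s) * \<omega>1 s) * indicator {0..} s"
        using gf[unfolded AE_lebesgue_on_iff[OF half_line_lebesgue]]
        by eventually_elim (use w1.pos in \<open>auto simp: indicator_def ennreal_mult less_imp_le\<close>)
    qed
    also have "\<dots> = (\<integral>\<^sup>+s. ennreal (cmod (f s) * \<omega>1 s) \<partial>lebesgue_on {0..})"
      by (simp add: nn_integral_lebesgue_on)
    also have "\<dots> = ennreal (LINT x|lebesgue_on {0..}. cmod (f x) * \<omega>1 x)"
      by (rule nn_integral_eq_integral[OF w1.L1_fun_integrable[OF f]])
        (use w1.pos in \<open>auto intro!: AE_I2 simp: less_imp_le\<close>)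
    finally show ?thesis .
  qed
  have tonelli: "(\<integral>\<^sup>+x. ?A x * ennreal (w x) \<partial>lborel)
      \<le> ennreal (K * (LINT x|lebesgue_on {0..}. cmod (f x) * \<omega>1 x))"
  proof -
    have "(\<integral>\<^sup>+x. ?A x * ennreal (w x) \<partial>lborel) = (\<integral>\<^sup>+s. ennreal (cmod (g s)) *
        (\<integral>\<^sup>+t. ennreal (w (s / t)) * (ennreal (p t) * ennreal (1 / t)) \<partial>lborel) \<partial>lborel)"
      by (rule nn_integral_dilates_swap) (auto simp: p_zero)
    also have "\<dots> \<le> (\<integral>\<^sup>+s. ennreal (cmod (g s)) * (ennreal (K * \<omega>1 s) * indicator {0..} s) \<partial>lborel)"
      by (intro nn_integral_mono mult_left_mono inner) auto
    also have "\<dots> = (\<integral>\<^sup>+s. ennreal K *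
        (ennreal (cmod (g s)) * (ennreal (\<omega>1 s) * indicator {0..} s)) \<partial>lborel)"
      using K_nonneg w1.pos
      by (intro nn_integral_cong) (auto simp: indicator_def ennreal_mult less_imp_le mult_ac)
    also have "\<dots> = ennreal K *
        (\<integral>\<^sup>+s. ennreal (cmod (g s)) * (ennreal (\<omega>1 s) * indicator {0..} s) \<partial>lborel)"
    proof (rule nn_integral_cmult)
      have [measurable]: "(\<lambda>s. indicator {0..} s * \<omega>1 s) \<in> borel_measurable borel"
        using borel_measurable_continuous_on_indicator[OF _ w1.cont] by simp
      have "(\<lambda>s. ennreal (cmod (g s)) * ennreal (indicator {0..} s * \<omega>1 s)) \<in> borel_measurable lborel"
        by measurable
      moreover have "ennreal (cmod (g s)) * ennreal (indicator {0..} s * \<omega>1 s)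
          = ennreal (cmod (g s)) * (ennreal (\<omega>1 s) * indicator {0..} s)" for s
        by (auto simp: indicator_def)
      ultimately show "(\<lambda>s. ennreal (cmod (g s)) * (ennreal (\<omega>1 s) * indicator {0..} s))
          \<in> borel_measurable lborel" by simp
    qed
    also have "\<dots> = ennreal (K * (LINT x|lebesgue_on {0..}. cmod (f x) * \<omega>1 x))"
      using K_nonneg by (simp add: norm_f ennreal_mult')
    finally show ?thesis .
  qed
  have "AE x in lborel. ?A x * ennreal (w x) \<noteq> \<infinity>"
    by (rule nn_integral_PInf_AE) (use tonelli in \<open>auto simp: top_unique\<close>)
  with AE_lborel_singleton[of "0 :: real"]
  have "AE x in lborel. x \<in> {0..} \<longrightarrow>
      integrable (lebesgue_on {0..1}) (\<lambda>t. f (t * x) * complex_of_real (\<psi> t))"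
  proof eventually_elim
    case (elim x)
    show ?case
    proof
      assume "x \<in> {0..}"
      then have x: "0 < x" using elim(1) by simp
      then have "0 < w x" using w2.pos[of x] by (simp add: w_def)
      then have fin: "?A x < \<infinity>"
        using elim(2) by (auto simp: ennreal_mult_eq_top_iff less_top)
      have "integrable lborel (\<lambda>t. g (t * x) * complex_of_real (p t))"
        using fin p_nonneg
        by (intro integrableI_bounded) (auto simp: norm_mult ennreal_mult[symmetric])
      then have "integrable (lebesgue_on {0..1}) (\<lambda>t. g (t * x) * complex_of_real (p t))"
        by (subst integrable_restrict_space) (auto simp: restrict integrable_completion)
      then show "integrable (lebesgue_on {0..1}) (\<lambda>t. f (t * x) * complex_of_real (\<psi> t))"
        by (rule integrable_cong_AE[OF kernel_meas[OF x] kernel_AE[OF x], THEN iffD2])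
    qed
  qed
  then show "AE x in lebesgue_on {0..}.
      integrable (lebesgue_on {0..1}) (\<lambda>t. f (t * x) * complex_of_real (\<psi> t))"
    by (simp add: AE_lebesgue_on_iff)
  \<comment> \<open>At \<open>x = 0\<close> the integrand depends on the single value \<open>f 0\<close>, so that \<open>V\<close> may differ from the
    operator there.\<close>
  have U_meas [measurable]: "hardy_cesaro \<psi> f \<in> borel_measurable (lebesgue_on {0..})"
  proof -
    have "(\<lambda>x. if x = 0 then hardy_cesaro \<psi> f 0 else V x) \<in> borel_measurable (lebesgue_on {0..})"
      by (intro measurable_restrict_space1 measurable_completion) measurable
    then show ?thesis
      by (rule measurable_cong[THEN iffD1, rotated]) (auto simp: U_eq)
  qed
  have U_bound: "(\<integral>\<^sup>+x. ennreal (cmod (hardy_cesaro \<psi> f x) * \<omega>2 x) \<partial>lebesgue_on {0..})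
      \<le> ennreal (K * (LINT x|lebesgue_on {0..}. cmod (f x) * \<omega>1 x))"
  proof -
    have "(\<integral>\<^sup>+x. ennreal (cmod (hardy_cesaro \<psi> f x) * \<omega>2 x) \<partial>lebesgue_on {0..})
        = (\<integral>\<^sup>+x. ennreal (cmod (hardy_cesaro \<psi> f x) * \<omega>2 x) * indicator {0..} x \<partial>lborel)"
      by (simp add: nn_integral_lebesgue_on)
    also have "\<dots> = (\<integral>\<^sup>+x. ennreal (cmod (V x)) * ennreal (w x) \<partial>lborel)"
    proof (rule nn_integral_cong_AE)
      show "AE x in lborel. ennreal (cmod (hardy_cesaro \<psi> f x) * \<omega>2 x) * indicator {0..} x
          = ennreal (cmod (V x)) * ennreal (w x)"
        using AE_lborel_singleton[of "0 :: real"]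
        by eventually_elim
          (use w2.pos in \<open>auto simp: U_eq w_def indicator_def ennreal_mult less_imp_le\<close>)
    qed
    also have "\<dots> \<le> (\<integral>\<^sup>+x. ?A x * ennreal (w x) \<partial>lborel)"
    proof (intro nn_integral_mono mult_right_mono)
      fix x
      have "ennreal (cmod (V x)) \<le> (\<integral>\<^sup>+t. ennreal (cmod (g (t * x) * complex_of_real (p t))) \<partial>lborel)"
      proof (cases "integrable lborel (\<lambda>t. g (t * x) * complex_of_real (p t))")
        case True
        then show ?thesis unfolding V_def by (rule integral_norm_bound_ennreal)
      next
        case False
        then have "V x = 0" unfolding V_def by (rule not_integrable_integral_eq)
        then show ?thesis by simp
      qed
      also have "\<dots> = ?A x" using p_nonneg by (simp add: norm_mult ennreal_mult)
      finally show "ennreal (cmod (V x)) \<le> ?A x" .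
    qed simp
    finally show ?thesis using tonelli by (rule order_trans)
  qed
  show U_L1: "hardy_cesaro \<psi> f \<in> L1_fun \<omega>2"
    by (rule w2.L1_funI_nn_integral) (use le_less_trans[OF U_bound] in auto)
  have nonneg: "0 \<le> (LINT x|lebesgue_on {0..}. cmod (f x) * \<omega>1 x)"
    using w1.pos by (auto intro!: integral_nonneg_AE AE_I2 simp: less_imp_le)
  have "(\<integral>\<^sup>+x. ennreal (cmod (hardy_cesaro \<psi> f x) * \<omega>2 x) \<partial>lebesgue_on {0..})
      = ennreal (LINT x|lebesgue_on {0..}. cmod (hardy_cesaro \<psi> f x) * \<omega>2 x)"
    by (rule nn_integral_eq_integral[OF w2.L1_fun_integrable[OF U_L1]])
      (use w2.pos in \<open>auto intro!: AE_I2 simp: less_imp_le\<close>)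
  with U_bound show "(LINT x|lebesgue_on {0..}. cmod (hardy_cesaro \<psi> f x) * \<omega>2 x)
      \<le> K * (LINT x|lebesgue_on {0..}. cmod (f x) * \<omega>1 x)"
    using nonneg K_nonneg by (simp add: ennreal_le_iff)
qed

lemma hardy_cesaro_cong_AE:
  assumes "f \<in> L1_fun \<omega>1" "g \<in> L1_fun \<omega>1"
    and "AE t in lebesgue_on {0..}. f t = g t" and "0 < x"
  shows "hardy_cesaro \<psi> f x = hardy_cesaro \<psi> g x"
  unfolding hardy_cesaro_def
proof (rule integral_cong_AE)
  note [measurable] = borel_measurable_dilation[OF w1.L1_fun_measurable[OF assms(1)] less_imp_le[OF \<open>0 < x\<close>]]
    borel_measurable_dilation[OF w1.L1_fun_measurable[OF assms(2)] less_imp_le[OF \<open>0 < x\<close>]]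
  show "(\<lambda>t. f (t * x) * complex_of_real (\<psi> t)) \<in> borel_measurable (lebesgue_on {0..1})"
    "(\<lambda>t. g (t * x) * complex_of_real (\<psi> t)) \<in> borel_measurable (lebesgue_on {0..1})"
    by measurable
  show "AE t in lebesgue_on {0..1}. f (t * x) * complex_of_real (\<psi> t) = g (t * x) * complex_of_real (\<psi> t)"
    using AE_dilation[OF assms(3,4)] by eventually_elim simp
qed

lemma hardy_cesaro_op_class:
  assumes "f \<in> L1_fun \<omega>1"
  shows "hardy_cesaro_op \<psi> \<omega>2 (L1_class \<omega>1 f) = L1_class \<omega>2 (hardy_cesaro \<psi> f)"
proof -
  have "L1_class \<omega>2 (hardy_cesaro \<psi> g) = L1_class \<omega>2 (hardy_cesaro \<psi> f)" if "g \<in> L1_class \<omega>1 f" for g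
  proof (rule w2.L1_class_cong_AE)
    show "AE x in lebesgue_on {0..}. hardy_cesaro \<psi> g x = hardy_cesaro \<psi> f x"
      using AE_lebesgue_on_pos[OF half_line_lebesgue order_refl]
      by eventually_elim (use that assms in \<open>auto simp: L1_class_def intro: hardy_cesaro_cong_AE\<close>)
  qed
  moreover have "L1_class \<omega>1 f \<noteq> {}"
    using assms w1.mem_L1_class by blast
  ultimately show ?thesis
    unfolding hardy_cesaro_op_def by (intro SUP_eq_const)
qed

text \<open>
  Additivity holds only almost everywhere at the level of functions, namely where both integrals
  converge; this suffices for the classes.
\<close>

lemma hardy_cesaro_bounded_operator:
  "bounded_operator (L1 \<omega>1) (L1 \<omega>2) (hardy_cesaro_op \<psi> \<omega>2)"
  unfolding bounded_operator_def w1.carrier_L1 w2.carrier_L1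
proof (intro conjI ballI allI exI)
  fix F assume "F \<in> L1_class \<omega>1 ` L1_fun \<omega>1"
  then obtain f where f: "f \<in> L1_fun \<omega>1" and F: "F = L1_class \<omega>1 f" by auto
  note Uf = hardy_cesaro_L1_fun[OF f]
  show "hardy_cesaro_op \<psi> \<omega>2 F \<in> L1_class \<omega>2 ` L1_fun \<omega>2"
    using Uf by (simp add: F hardy_cesaro_op_class f)
  show "vnorm (L1 \<omega>2) (hardy_cesaro_op \<psi> \<omega>2 F) \<le> K * vnorm (L1 \<omega>1) F"
    using hardy_cesaro_norm_le[OF f]
    by (simp add: F hardy_cesaro_op_class f w1.vnorm_L1 w2.vnorm_L1 Uf)
  have "hardy_cesaro \<psi> (\<lambda>t. c * f t) = (\<lambda>x. c * hardy_cesaro \<psi> f x)" for c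
    by (rule ext) (simp add: hardy_cesaro_def mult.assoc)
  then show "hardy_cesaro_op \<psi> \<omega>2 (vscale (L1 \<omega>1) c F) = vscale (L1 \<omega>2) c (hardy_cesaro_op \<psi> \<omega>2 F)" for c
    by (simp add: F w1.vscale_L1 w2.vscale_L1 f Uf hardy_cesaro_op_class w1.L1_fun_scale)
  fix G assume "G \<in> L1_class \<omega>1 ` L1_fun \<omega>1"
  then obtain g where g: "g \<in> L1_fun \<omega>1" and G: "G = L1_class \<omega>1 g" by auto
  note Ug = hardy_cesaro_L1_fun[OF g]
  have "AE x in lebesgue_on {0..}.
      hardy_cesaro \<psi> (\<lambda>t. f t + g t) x = hardy_cesaro \<psi> f x + hardy_cesaro \<psi> g x"
    using hardy_cesaro_integrable[OF f] hardy_cesaro_integrable[OF g]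
    by eventually_elim (simp add: hardy_cesaro_def distrib_right)
  then have "L1_class \<omega>2 (hardy_cesaro \<psi> (\<lambda>t. f t + g t))
      = L1_class \<omega>2 (\<lambda>x. hardy_cesaro \<psi> f x + hardy_cesaro \<psi> g x)"
    by (rule w2.L1_class_cong_AE)
  then show "hardy_cesaro_op \<psi> \<omega>2 (vadd (L1 \<omega>1) F G)
      = vadd (L1 \<omega>2) (hardy_cesaro_op \<psi> \<omega>2 F) (hardy_cesaro_op \<psi> \<omega>2 G)"
    by (simp add: F G w1.vadd_L1 w2.vadd_L1 f g Uf Ug hardy_cesaro_op_class w1.L1_fun_add)
qed

end

section \<open>A double limit criterion for the failure of weak compactness\<close>

lemma openin_weak_topology:
  assumes "bounded_operator X complex_space \<phi>" and "open V"
  shows "openin (weak_topology X) {u \<in> vcarrier X. \<phi> u \<in> V}"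
  unfolding weak_topology_def using assms by (intro topology_generated_by_Basis) blast

lemma topspace_weak_topology_subset: "topspace (weak_topology X) \<subseteq> vcarrier X"
  unfolding weak_topology_def by auto

text \<open>
  A double limit criterion. A weak cluster point \<open>v\<close> of the images \<open>T (u n)\<close> would satisfy
  \<open>\<phi> k v = 0\<close> for every \<open>k\<close>, hence \<open>\<phi>\<^sub>0 v = 0\<close> in the limit, although \<open>Re (\<phi>\<^sub>0 v) \<ge> c\<close>. The proof
  phrases this through covers: every vector has either \<open>Re (\<phi>\<^sub>0 v) < c\<close> or \<open>c / 2 < \<bar>\<phi> k v\<bar>\<close> for
  some \<open>k\<close>, but finitely many of these weakly open sets miss \<open>T (u n)\<close> when \<open>n\<close> is large.
\<close>

lemma not_weakly_compact_if_mass_escapes: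
  fixes \<phi> :: "nat \<Rightarrow> 'b \<Rightarrow> complex"
  assumes \<phi>: "\<And>k. bounded_operator Y complex_space (\<phi> k)"
    and \<phi>\<^sub>0: "bounded_operator Y complex_space \<phi>\<^sub>0"
    and lim: "\<And>v. v \<in> vcarrier Y \<Longrightarrow> (\<lambda>k. \<phi> k v) \<longlonglongrightarrow> \<phi>\<^sub>0 v"
    and u: "\<And>n. u n \<in> unit_cball X"
    and c: "0 < c" "\<And>n. c \<le> Re (\<phi>\<^sub>0 (T (u n)))"
    and escape: "\<And>k. (\<lambda>n. \<phi> k (T (u n))) \<longlonglongrightarrow> 0"
  shows "\<not> weakly_compact_operator X Y T"
proof
  let ?W = "weak_topology Y"
  let ?C = "?W closure_of (T ` unit_cball X)"
  assume wc: "weakly_compact_operator X Y T"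
  then have T: "bounded_operator X Y T" and compact: "compactin ?W ?C"
    by (auto simp: weakly_compact_operator_def)
  have carrier: "T x \<in> vcarrier Y" if "x \<in> unit_cball X" for x
    using T that by (auto simp: bounded_operator_def unit_cball_def)
  have "T ` unit_cball X \<subseteq> topspace ?W"
    using openin_subset[OF openin_weak_topology[OF \<phi>\<^sub>0 open_UNIV]] carrier by auto
  then have in_C: "T (u n) \<in> ?C" for n
    using closure_of_subset u by blast
  define small where "small = {v \<in> vcarrier Y. \<phi>\<^sub>0 v \<in> {z. Re z < c}}"
  define seen where "seen k = {v \<in> vcarrier Y. \<phi> k v \<in> {z. c / 2 < cmod z}}" for k
  have "openin ?W small"
    unfolding small_def by (rule openin_weak_topology[OF \<phi>\<^sub>0 open_halfspace_Re_lt])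
  moreover have "openin ?W (seen k)" for k
    unfolding seen_def
    by (rule openin_weak_topology[OF \<phi>]) (intro open_Collect_less continuous_intros)
  ultimately have opens: "\<forall>U\<in>insert small (range seen). openin ?W U" by blast
  have cover: "?C \<subseteq> \<Union>(insert small (range seen))"
  proof
    fix v assume "v \<in> ?C"
    then have v: "v \<in> vcarrier Y"
      by (rule subsetD[OF topspace_weak_topology_subset subsetD[OF closure_of_subset_topspace]])
    show "v \<in> \<Union>(insert small (range seen))"
    proof (cases "v \<in> small")
      case False
      then have "c \<le> Re (\<phi>\<^sub>0 v)" using v by (simp add: small_def)
      then have "c / 2 < cmod (\<phi>\<^sub>0 v)" using c(1) complex_Re_le_cmod[of "\<phi>\<^sub>0 v"] by linarith
      then have "eventually (\<lambda>k. c / 2 < cmod (\<phi> k v)) sequentially"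
        using tendsto_norm[OF lim[OF v]] by (rule order_tendstoD(1)[rotated])
      then obtain k where "c / 2 < cmod (\<phi> k v)" by (auto simp: eventually_sequentially)
      then show ?thesis using v by (auto simp: seen_def)
    qed simp
  qed
  obtain \<F> where "finite \<F>" and \<F>: "\<F> \<subseteq> insert small (range seen)" "?C \<subseteq> \<Union>\<F>"
    using compact[unfolded compactin_def, THEN conjunct2, THEN spec, THEN mp, OF conjI[OF opens cover]]
    by blast
  from \<F>(1) have "\<F> - {small} \<subseteq> range seen" by blast
  with \<open>finite \<F>\<close> obtain S where "finite S" and S: "\<F> - {small} = seen ` S"
    by (meson finite_Diff finite_subset_image)
  have "eventually (\<lambda>n. \<forall>k\<in>S. cmod (\<phi> k (T (u n))) < c / 2) sequentially"
  proof (rule eventually_ball_finite[OF \<open>finite S\<close>], rule ballI)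
    fix k
    show "eventually (\<lambda>n. cmod (\<phi> k (T (u n))) < c / 2) sequentially"
      using tendsto_norm[OF escape[of k]] c(1) by (intro order_tendstoD(2)) auto
  qed
  then obtain n where n: "\<forall>k\<in>S. cmod (\<phi> k (T (u n))) < c / 2"
    by (auto simp: eventually_sequentially)
  have "T (u n) \<notin> small" using c(2)[of n] by (simp add: small_def)
  moreover have "T (u n) \<notin> seen k" if "k \<in> S" for k using n that by (force simp: seen_def)
  ultimately show False using in_C[of n] \<F>(2) S by blast
qed

section \<open>Integration over subintervals as a bounded functional\<close>

text \<open>
  A class is an arbitrary set of functions here, so the functional picks a representative.
\<close>

definition interval_functional :: "real \<Rightarrow> (real \<Rightarrow> complex) set \<Rightarrow> complex" where
  "interval_functional a F = (LINT x|lebesgue_on {a..1}. (SOME f. f \<in> F) x)"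

context weight
begin

text \<open>
  A positive continuous weight has a positive minimum \<open>m\<close> on the unit interval, whence
  \<open>\<bar>f\<bar> \<le> \<bar>f\<bar> * w / m\<close> there.
\<close>

lemma interval_integral_bound:
  obtains M where "\<And>a f. 0 \<le> a \<Longrightarrow> f \<in> L1_fun w \<Longrightarrow> integrable (lebesgue_on {a..1}) f"
    and "\<And>a f. 0 \<le> a \<Longrightarrow> f \<in> L1_fun w \<Longrightarrow>
      cmod (LINT x|lebesgue_on {a..1}. f x) \<le> M * (LINT x|lebesgue_on {0..}. cmod (f x) * w x)"
proof -
  obtain x0 where "x0 \<in> {0..1}" and x0: "\<And>x. x \<in> {0..1} \<Longrightarrow> w x0 \<le> w x"
    using continuous_attains_inf[of "{0..1}" w] continuous_on_subset[OF cont, of "{0..1}"] by auto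
  define m where "m = w x0"
  have m: "0 < m" using \<open>x0 \<in> {0..1}\<close> pos by (simp add: m_def)
  have main: "integrable (lebesgue_on {a..1}) f \<and>
      cmod (LINT x|lebesgue_on {a..1}. f x) \<le> 1 / m * (LINT x|lebesgue_on {0..}. cmod (f x) * w x)"
    if a: "0 \<le> a" and f: "f \<in> L1_fun w" for a f
  proof -
    let ?g = "\<lambda>x. indicator {0..} x *\<^sub>R (cmod (f x) * w x)"
    have g: "integrable lebesgue ?g"
      using L1_fun_integrable[OF f] by (subst (asm) integrable_restrict_space) auto
    have f_meas: "f \<in> borel_measurable (lebesgue_on {a..1})"
      by (rule measurable_restrict_mono[OF L1_fun_measurable[OF f]]) (use a in auto)
    then have f_meas': "(\<lambda>x. indicator {a..1} x *\<^sub>R f x) \<in> borel_measurable lebesgue"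
      by (subst borel_measurable_restrict_space_iff[symmetric]) auto
    have le: "norm (indicator {a..1} x *\<^sub>R f x) \<le> 1 / m * ?g x" for x
    proof (cases "x \<in> {a..1}")
      case True
      then have "m \<le> w x" using x0 a by (simp add: m_def)
      then have "cmod (f x) * m \<le> cmod (f x) * w x" by (rule mult_left_mono) simp
      then show ?thesis using True a m by (simp add: field_simps)
    next
      case False
      then have "indicator {a..1} x *\<^sub>R f x = 0" by simp
      moreover have "0 \<le> 1 / m * ?g x" using m pos[of x] by (cases "0 \<le> x") auto
      ultimately show ?thesis by (simp only: norm_zero)
    qed
    have int: "integrable lebesgue (\<lambda>x. indicator {a..1} x *\<^sub>R f x)"
      by (rule Bochner_Integration.integrable_bound[OF integrable_mult_right[OF g, of "1 / m"] f_meas'])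
        (rule AE_I2, simp only: real_norm_def, rule order_trans[OF le abs_ge_self])
    have "cmod (LINT x|lebesgue_on {a..1}. f x) = cmod (LINT x|lebesgue. indicator {a..1} x *\<^sub>R f x)"
      by (subst integral_restrict_space) auto
    also have "\<dots> \<le> (LINT x|lebesgue. norm (indicator {a..1} x *\<^sub>R f x))"
      by (rule integral_norm_bound)
    also have "\<dots> \<le> (LINT x|lebesgue. 1 / m * ?g x)"
      by (rule integral_mono[OF integrable_norm[OF int] integrable_mult_right[OF g] le])
    also have "\<dots> = 1 / m * (LINT x|lebesgue_on {0..}. cmod (f x) * w x)"
      by (subst integral_restrict_space) (simp_all only: integral_mult_right_zero, simp_all)
    finally show ?thesis
      using int by (subst integrable_restrict_space) auto
  qed
  show thesis using main by (intro that[of "1 / m"]) blast+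
qed

lemma integrable_on_interval:
  assumes "f \<in> L1_fun w" and "0 \<le> a"
  shows "integrable (lebesgue_on {a..1}) f"
  by (rule interval_integral_bound) (use assms in blast)

lemma interval_functional_class:
  assumes f: "f \<in> L1_fun w" and a: "0 \<le> a"
  shows "interval_functional a (L1_class w f) = (LINT x|lebesgue_on {a..1}. f x)"
proof -
  define g where "g = (SOME g. g \<in> L1_class w f)"
  have "g \<in> L1_class w f"
    unfolding g_def by (rule someI[of "\<lambda>g. g \<in> L1_class w f", OF mem_L1_class[OF f]])
  then have g: "g \<in> L1_fun w" and eq: "AE t in lebesgue_on {0..}. g t = f t"
    by (auto simp: L1_class_def)
  have "AE t in lborel. t \<in> {0..} \<longrightarrow> g t = f t"
    using eq by (subst (asm) AE_lebesgue_on_iff) auto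
  then have "AE t in lborel. t \<in> {a..1} \<longrightarrow> g t = f t"
    by eventually_elim (use a in auto)
  then have "AE t in lebesgue_on {a..1}. g t = f t"
    by (subst AE_lebesgue_on_iff) auto
  then have "(LINT x|lebesgue_on {a..1}. g x) = (LINT x|lebesgue_on {a..1}. f x)"
    using integrable_on_interval[OF f a] integrable_on_interval[OF g a]
    by (intro integral_cong_AE) auto
  then show ?thesis by (simp add: interval_functional_def g_def)
qed

lemma interval_functional_bounded:
  assumes a: "0 \<le> a"
  shows "bounded_operator (L1 w) complex_space (interval_functional a)"
proof -
  obtain M where M: "\<And>a f. 0 \<le> a \<Longrightarrow> f \<in> L1_fun w \<Longrightarrow>
      cmod (LINT x|lebesgue_on {a..1}. f x) \<le> M * (LINT x|lebesgue_on {0..}. cmod (f x) * w x)"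
    by (rule interval_integral_bound) blast
  show ?thesis
    unfolding bounded_operator_def carrier_L1
    using M[OF a] integrable_on_interval[OF _ a]
    by (auto simp: complex_space_def interval_functional_class a vadd_L1 vscale_L1 vnorm_L1
        L1_fun_add L1_fun_scale)
qed

lemma interval_functional_tendsto:
  assumes "F \<in> vcarrier (L1 w)"
  shows "(\<lambda>k. interval_functional (1 / real (Suc k)) F) \<longlonglongrightarrow> interval_functional 0 F"
proof -
  obtain f where f: "f \<in> L1_fun w" and F: "F = L1_class w f"
    using assms by (auto simp: carrier_L1)
  let ?a = "\<lambda>k. 1 / real (Suc k)"
  have int: "integrable lebesgue (\<lambda>x. indicator {a..1} x *\<^sub>R f x)" if "0 \<le> a" for a
    using integrable_on_interval[OF f that] by (subst (asm) integrable_restrict_space) auto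
  have "(\<lambda>k. LINT x|lebesgue. indicator {?a k..1} x *\<^sub>R f x)
      \<longlonglongrightarrow> (LINT x|lebesgue. indicator {0..1} x *\<^sub>R f x)"
  proof (rule integral_dominated_convergence)
    show "integrable lebesgue (\<lambda>x. norm (indicator {0..1} x *\<^sub>R f x))"
      using int by (intro integrable_norm) simp
    show "AE x in lebesgue. norm (indicator {?a k..1} x *\<^sub>R f x) \<le> norm (indicator {0..1} x *\<^sub>R f x)" for k
      by (rule AE_I2) (auto simp: indicator_def intro: order_trans[rotated])
    show "AE x in lebesgue. (\<lambda>k. indicator {?a k..1} x *\<^sub>R f x) \<longlonglongrightarrow> indicator {0..1} x *\<^sub>R f x"
      using AE_completion[OF AE_lborel_singleton[of "0 :: real"]]
    proof eventually_elim
      case (elim x)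
      show ?case
      proof (rule tendsto_eventually, cases "0 < x")
        case True
        then have "eventually (\<lambda>k. ?a k < x) sequentially"
          using LIMSEQ_inverse_real_of_nat by (intro order_tendstoD(2)[of _ 0]) (auto simp: divide_inverse)
        then show "eventually (\<lambda>k. indicator {?a k..1} x *\<^sub>R f x = indicator {0..1} x *\<^sub>R f x) sequentially"
          by eventually_elim (use True in \<open>auto simp: indicator_def\<close>)
      next
        case False
        then have "x < 0" using elim by simp
        moreover have "0 \<le> ?a k" for k by simp
        ultimately have "x \<notin> {?a k..1}" "x \<notin> {0..1}" for k
          by (smt (verit) atLeastAtMost_iff)+
        then have "indicator {?a k..1} x *\<^sub>R f x = indicator {0..1} x *\<^sub>R f x" for k
          by simp
        then show "eventually (\<lambda>k. indicator {?a k..1} x *\<^sub>R f x = indicator {0..1} x *\<^sub>R f x) sequentially"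
          by (intro always_eventually allI)
      qed
    qed
  qed (use int in \<open>auto intro: borel_measurable_integrable\<close>)
  then show ?thesis
    by (simp add: F interval_functional_class f integral_restrict_space)
qed

end

section \<open>Images of functions concentrating at the origin\<close>

text \<open>
  Up to the constant \<open>c\<close>, these are the uniform probability densities on \<open>{0..1 / \<nu>}\<close>, extended by
  a constant to the negative arguments, where values are ignored.
\<close>

definition bump :: "real \<Rightarrow> real \<Rightarrow> real \<Rightarrow> complex" where
  "bump c \<nu> t = complex_of_real (c * \<nu> * indicator {..1 / \<nu>} t)"

text \<open>
  If \<open>W\<close> is the maximum of the weight on the unit interval, then \<open>c = 1 / W\<close> works: for \<open>1 \<le> \<nu>\<close> a
  bump vanishes on \<open>{1<..}\<close>.
\<close>

lemma (in weight) bump_unit_cball: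
  obtains c where "0 < c" and "\<And>\<nu>. 1 \<le> \<nu> \<Longrightarrow> bump c \<nu> \<in> L1_fun w"
    and "\<And>\<nu>. 1 \<le> \<nu> \<Longrightarrow> L1_class w (bump c \<nu>) \<in> unit_cball (L1 w)"
proof -
  obtain x0 where "x0 \<in> {0..1}" and x0: "\<And>x. x \<in> {0..1} \<Longrightarrow> w x \<le> w x0"
    using continuous_attains_sup[of "{0..1}" w] continuous_on_subset[OF cont, of "{0..1}"] by auto
  define c where "c = 1 / w x0"
  have w0: "0 < w x0" using \<open>x0 \<in> {0..1}\<close> pos by simp
  have "0 < c" using w0 by (simp add: c_def)
  have main: "bump c \<nu> \<in> L1_fun w \<and> (LINT t|lebesgue_on {0..}. cmod (bump c \<nu> t) * w t) \<le> 1"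
    if \<nu>: "1 \<le> \<nu>" for \<nu>
  proof -
    let ?h = "\<lambda>t. \<nu> * indicator {0..1 / \<nu>} t :: real"
    have meas: "bump c \<nu> \<in> borel_measurable (lebesgue_on {0..})"
      unfolding bump_def by (intro measurable_restrict_space1 measurable_completion) measurable
    have le: "cmod (bump c \<nu> t) * w t \<le> ?h t" if "t \<in> space (lebesgue_on {0..})" for t
    proof (cases "t \<le> 1 / \<nu>")
      case True
      have "1 / \<nu> \<le> 1" using \<nu> by simp
      then have "w t \<le> w x0" using True that by (intro x0) auto
      then have "c * w t \<le> 1" using w0 by (simp add: c_def divide_le_eq)
      then have "\<nu> * (c * w t) \<le> \<nu> * 1" using \<nu> by (intro mult_left_mono) auto
      moreover have "cmod (bump c \<nu> t) = c * \<nu>"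
        using True \<open>0 < c\<close> \<nu> unfolding bump_def norm_of_real by simp
      ultimately show ?thesis using True that by (simp add: mult_ac)
    qed (simp add: bump_def)
    have fin: "emeasure (lebesgue_on {0..}) {0..1 / \<nu>} = ennreal (1 / \<nu>)"
      using \<nu> by (subst emeasure_restrict_space) auto
    have sets: "{0..1 / \<nu>} \<in> sets (lebesgue_on {0..})"
      by (subst sets_restrict_space_iff) auto
    have h: "has_bochner_integral (lebesgue_on {0..}) ?h (\<nu> * (1 / \<nu>))"
    proof (rule has_bochner_integral_mult_right)
      have "has_bochner_integral (lebesgue_on {0..}) (indicator {0..1 / \<nu>} :: real \<Rightarrow> real)
          (measure (lebesgue_on {0..}) {0..1 / \<nu>})"
        using sets fin by (intro has_bochner_integral_real_indicator) auto
      then show "has_bochner_integral (lebesgue_on {0..}) (indicator {0..1 / \<nu>} :: real \<Rightarrow> real) (1 / \<nu>)"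
        using fin \<nu> by (simp add: measure_def)
    qed
    have int: "integrable (lebesgue_on {0..}) (\<lambda>t. cmod (bump c \<nu> t) * w t)"
    proof (rule Bochner_Integration.integrable_bound)
      show "integrable (lebesgue_on {0..}) ?h" using h by (rule integrable.intros)
      show "(\<lambda>t. cmod (bump c \<nu> t) * w t) \<in> borel_measurable (lebesgue_on {0..})"
        using meas by measurable
      show "AE t in lebesgue_on {0..}. norm (cmod (bump c \<nu> t) * w t) \<le> norm (?h t)"
      proof (rule AE_I2)
        fix t assume t: "t \<in> space (lebesgue_on {0 :: real..})"
        then have "0 \<le> cmod (bump c \<nu> t) * w t" using pos by (simp add: less_imp_le)
        then show "norm (cmod (bump c \<nu> t) * w t) \<le> norm (?h t)" using le[OF t] by simp
      qed
    qed
    have "(LINT t|lebesgue_on {0..}. cmod (bump c \<nu> t) * w t) \<le> (LINT t|lebesgue_on {0..}. ?h t)"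
      by (rule integral_mono[OF int integrable.intros[OF h] le])
    also have "\<dots> = 1" using has_bochner_integral_integral_eq[OF h] \<nu> by simp
    finally show ?thesis using meas int by (simp add: L1_fun_def)
  qed
  show thesis
    by (rule that[OF \<open>0 < c\<close>]) (use main in \<open>auto simp: unit_cball_def carrier_L1 vnorm_L1\<close>)
qed

context hardy_cesaro_bound
begin

text \<open>
  This is the integral condition at \<open>s = 0\<close>, where the weight \<open>\<omega>2 (s / t)\<close> is the constant \<open>\<omega>2 0\<close>.
\<close>

lemma integrable_psi_over_id: "integrable (lebesgue_on {0..1}) (\<lambda>t. \<psi> t / t)"
proof -
  have w20: "0 < \<omega>2 0" by (rule w2.pos) simp
  have "integrable (lebesgue_on {0..1}) (\<lambda>t. \<omega>2 0 * (\<psi> t / t))"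
  proof (rule integrableI_nonneg)
    have "(\<integral>\<^sup>+t. ennreal (\<omega>2 0 * (\<psi> t / t)) \<partial>lebesgue_on {0..1}) \<le> ennreal (K * \<omega>1 0)"
      using bound[of 0] by simp
    then show "(\<integral>\<^sup>+t. ennreal (\<omega>2 0 * (\<psi> t / t)) \<partial>lebesgue_on {0..1}) < \<infinity>"
      by (rule le_less_trans) simp
    show "AE t in lebesgue_on {0..1}. 0 \<le> \<omega>2 0 * (\<psi> t / t)"
      using w20 psi_nonneg by (intro AE_I2) simp
    have [measurable]: "(\<lambda>t :: real. t) \<in> borel_measurable (lebesgue_on {0..1})"
      by (intro measurable_restrict_space1 measurable_completion) measurable
    show "(\<lambda>t. \<omega>2 0 * (\<psi> t / t)) \<in> borel_measurable (lebesgue_on {0..1})"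
      by measurable
  qed
  then show ?thesis using w20 by (simp only: integrable_mult_left_iff) simp
qed

lemma integrable_psi: "integrable (lebesgue_on {0..1}) \<psi>"
proof (rule Bochner_Integration.integrable_bound[OF integrable_psi_over_id psi_meas])
  show "AE t in lebesgue_on {0..1}. norm (\<psi> t) \<le> norm (\<psi> t / t)"
    using AE_lebesgue_on_pos[OF unit_interval_lebesgue unit_interval_subset] AE_space[of "lebesgue_on {0..1}"]
  proof eventually_elim
    case (elim t)
    then have "\<bar>\<psi> t\<bar> * t \<le> \<bar>\<psi> t\<bar> * 1" by (intro mult_left_mono) auto
    then show ?case using elim by (simp add: le_divide_eq)
  qed
qed

definition tail :: "real \<Rightarrow> real" where
  "tail \<delta> = (LINT t|lebesgue_on {0..1}. indicator {..\<delta>} t * (\<psi> t / t))"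

lemma integrable_tail: "integrable (lebesgue_on {0..1}) (\<lambda>t. indicator {..\<delta>} t * (\<psi> t / t))"
proof -
  have "{..\<delta>} \<inter> {0..1} \<in> sets (lebesgue_on {0..1})"
    by (subst sets_restrict_space_iff) auto
  from integrable_mult_indicator[OF this integrable_psi_over_id]
  show ?thesis
    by (rule Bochner_Integration.integrable_cong[THEN iffD1, rotated -1]) (auto simp: indicator_def)
qed

lemma tail_tendsto_0: "(\<lambda>n. tail (\<delta> / real (Suc n))) \<longlonglongrightarrow> 0"
proof -
  have lim: "(\<lambda>n. \<delta> / real (Suc n)) \<longlonglongrightarrow> 0"
    using tendsto_mult[OF tendsto_const[of \<delta>] LIMSEQ_inverse_real_of_nat] by (simp add: divide_inverse)
  have "(\<lambda>n. tail (\<delta> / real (Suc n))) \<longlonglongrightarrow> (LINT t|lebesgue_on {0..1 :: real}. 0)"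
    unfolding tail_def
  proof (rule integral_dominated_convergence)
    show "integrable (lebesgue_on {0..1}) (\<lambda>t. \<bar>\<psi> t / t\<bar>)"
      by (rule integrable_abs[OF integrable_psi_over_id])
    show "AE t in lebesgue_on {0..1}. norm (indicator {..\<delta> / real (Suc n)} t * (\<psi> t / t)) \<le> \<bar>\<psi> t / t\<bar>" for n
      by (rule AE_I2) (simp add: indicator_def)
    show "AE t in lebesgue_on {0..1}. (\<lambda>n. indicator {..\<delta> / real (Suc n)} t * (\<psi> t / t)) \<longlonglongrightarrow> 0"
      using AE_lebesgue_on_pos[OF unit_interval_lebesgue unit_interval_subset]
    proof eventually_elim
      case (elim t)
      have "eventually (\<lambda>n. \<delta> / real (Suc n) < t) sequentially"
        using order_tendstoD(2)[OF lim elim] .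
      then have "eventually (\<lambda>n. indicator {..\<delta> / real (Suc n)} t * (\<psi> t / t) = 0) sequentially"
        by eventually_elim auto
      then show ?case by (rule tendsto_eventually)
    qed
  qed (use integrable_tail in \<open>auto intro: borel_measurable_integrable\<close>)
  then show ?thesis by simp
qed

text \<open>
  Up to the factor \<open>c * \<nu>\<close>, the image of a bump under the Hardy-Cesaro operator.
\<close>

definition bump_profile :: "real \<Rightarrow> real \<Rightarrow> real" where
  "bump_profile \<nu> x = (LINT t|lebesgue_on {0..1}. indicator {..1 / \<nu>} (t * x) * \<psi> t)"

lemma hardy_cesaro_bump:
  "hardy_cesaro \<psi> (bump c \<nu>) x = complex_of_real (c * \<nu> * bump_profile \<nu> x)"
proof -
  have "hardy_cesaro \<psi> (bump c \<nu>) x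
      = (LINT t|lebesgue_on {0..1}. complex_of_real (c * \<nu> * (indicator {..1 / \<nu>} (t * x) * \<psi> t)))"
    unfolding hardy_cesaro_def bump_def by (intro Bochner_Integration.integral_cong) auto
  also have "\<dots> = complex_of_real (c * \<nu> * bump_profile \<nu> x)"
    unfolding bump_profile_def by (simp only: integral_complex_of_real integral_mult_right_zero)
  finally show ?thesis .
qed

lemma bump_profile_nonneg: "0 \<le> bump_profile \<nu> x"
  unfolding bump_profile_def using psi_nonneg by (intro integral_nonneg_AE AE_I2) simp

lemma bump_profile_near_0:
  assumes "1 \<le> \<nu>" "0 \<le> x" "x \<le> 1 / \<nu>"
  shows "bump_profile \<nu> x = (LINT t|lebesgue_on {0..1}. \<psi> t)"
  unfolding bump_profile_def
proof (rule Bochner_Integration.integral_cong[OF refl])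
  fix t assume "t \<in> space (lebesgue_on {0..1 :: real})"
  then have "t * x \<le> 1 * x" using assms by (intro mult_right_mono) auto
  then show "indicator {..1 / \<nu>} (t * x) * \<psi> t = \<psi> t" using assms by simp
qed

text \<open>
  If \<open>t * x \<le> 1 / \<nu>\<close> and \<open>a \<le> x\<close>, then \<open>t \<le> 1 / (a * \<nu>)\<close> and \<open>\<nu> \<le> 1 / (t * a)\<close>: the factor \<open>\<nu>\<close> is
  paid for by the factor \<open>1 / t\<close>, and only small \<open>t\<close> contribute. The bound is uniform in \<open>x\<close> and
  tends to zero as \<open>\<nu>\<close> grows.
\<close>

lemma bump_profile_away_from_0:
  assumes \<nu>: "1 \<le> \<nu>" and a: "0 < a" "a \<le> x"
  shows "\<nu> * bump_profile \<nu> x \<le> tail (1 / a / \<nu>) / a"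
proof -
  have x: "0 < x" using a by simp
  have "\<nu> * bump_profile \<nu> x = (LINT t|lebesgue_on {0..1}. \<nu> * (indicator {..1 / \<nu>} (t * x) * \<psi> t))"
    unfolding bump_profile_def by simp
  also have "\<dots> \<le> (LINT t|lebesgue_on {0..1}. 1 / a * (indicator {..1 / a / \<nu>} t * (\<psi> t / t)))"
  proof (rule integral_mono_AE')
    show "integrable (lebesgue_on {0..1}) (\<lambda>t. 1 / a * (indicator {..1 / a / \<nu>} t * (\<psi> t / t)))"
      by (rule integrable_mult_right[OF integrable_tail])
    show "AE t in lebesgue_on {0..1}. 0 \<le> 1 / a * (indicator {..1 / a / \<nu>} t * (\<psi> t / t))"
      using psi_nonneg a by (intro AE_I2) simp
    show "AE t in lebesgue_on {0..1}. \<nu> * (indicator {..1 / \<nu>} (t * x) * \<psi> t)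
        \<le> 1 / a * (indicator {..1 / a / \<nu>} t * (\<psi> t / t))"
      using AE_lebesgue_on_pos[OF unit_interval_lebesgue unit_interval_subset] AE_space[of "lebesgue_on {0..1}"]
    proof eventually_elim
      case (elim t)
      then have \<psi>t: "0 \<le> \<psi> t" using psi_nonneg by simp
      show ?case
      proof (cases "t * x \<le> 1 / \<nu>")
        case True
        have "t * a \<le> t * x" using a elim(1) by (intro mult_left_mono) auto
        with True have ta: "t * a \<le> 1 / \<nu>" by linarith
        then have "t \<le> 1 / a / \<nu>" using a \<nu> by (simp add: field_simps)
        moreover have "\<nu> \<le> 1 / (t * a)" using ta a elim(1) \<nu> by (simp add: field_simps)
        then have "\<nu> * \<psi> t \<le> 1 / (t * a) * \<psi> t" using \<psi>t by (rule mult_right_mono)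
        ultimately show ?thesis using True by (simp add: mult.commute)
      next
        case False
        then show ?thesis using \<psi>t a elim(1) by simp
      qed
    qed
  qed
  also have "\<dots> = tail (1 / a / \<nu>) / a"
    by (simp only: tail_def integral_mult_right_zero) simp
  finally show ?thesis .
qed

text \<open>
  The images \<open>h \<nu>\<close> of the bumps equal \<open>c * \<nu> * I\<close> on \<open>{0..1 / \<nu>}\<close>, with \<open>I\<close> the integral of \<open>\<psi>\<close>, and
  so have mass at least \<open>c * I\<close> on the unit interval, while their mass on \<open>{a..1}\<close> vanishes as \<open>\<nu>\<close>
  grows, for every positive \<open>a\<close>.
\<close>

lemma hardy_cesaro_not_weakly_compact:
  assumes nonzero: "\<not> (AE t in lebesgue_on {0..1}. \<psi> t = 0)"
  shows "\<not> weakly_compact_operator (L1 \<omega>1) (L1 \<omega>2) (hardy_cesaro_op \<psi> \<omega>2)"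
proof -
  define I where "I = (LINT t|lebesgue_on {0..1}. \<psi> t)"
  have "AE t in lebesgue_on {0..1}. 0 \<le> \<psi> t"
    using psi_nonneg by (intro AE_I2) simp
  then have "0 \<le> I" "I \<noteq> 0"
    using nonzero integral_nonneg_eq_0_iff_AE[OF integrable_psi]
    by (auto simp: I_def intro: integral_nonneg_AE)
  then have I: "0 < I" by simp
  obtain c where c: "0 < c" and bump_L1: "\<And>\<nu>. 1 \<le> \<nu> \<Longrightarrow> bump c \<nu> \<in> L1_fun \<omega>1"
    and bump_ball: "\<And>\<nu>. 1 \<le> \<nu> \<Longrightarrow> L1_class \<omega>1 (bump c \<nu>) \<in> unit_cball (L1 \<omega>1)"
    by (rule w1.bump_unit_cball) blast
  define h where "h \<nu> x = c * \<nu> * bump_profile \<nu> x" for \<nu> x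
  have U: "interval_functional a (hardy_cesaro_op \<psi> \<omega>2 (L1_class \<omega>1 (bump c \<nu>)))
      = complex_of_real (LINT x|lebesgue_on {a..1}. h \<nu> x)"
    and h_int: "integrable (lebesgue_on {a..1}) (h \<nu>)" if "0 \<le> a" "1 \<le> \<nu>" for a \<nu>
  proof -
    note f = bump_L1[OF that(2)]
    have Uf: "hardy_cesaro \<psi> (bump c \<nu>) = (\<lambda>x. complex_of_real (h \<nu> x))"
      by (rule ext) (simp add: hardy_cesaro_bump h_def)
    show "interval_functional a (hardy_cesaro_op \<psi> \<omega>2 (L1_class \<omega>1 (bump c \<nu>)))
      = complex_of_real (LINT x|lebesgue_on {a..1}. h \<nu> x)"
      using w2.interval_functional_class[OF hardy_cesaro_L1_fun[OF f] that(1)]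
      by (simp add: hardy_cesaro_op_class[OF f] Uf)
    show "integrable (lebesgue_on {a..1}) (h \<nu>)"
      using w2.integrable_on_interval[OF hardy_cesaro_L1_fun[OF f] that(1)]
      by (simp add: Uf complex_of_real_integrable_eq)
  qed
  have mass: "c * I \<le> (LINT x|lebesgue_on {0..1}. h \<nu> x)" if \<nu>: "1 \<le> \<nu>" for \<nu>
  proof -
    have sub: "{0..1 / \<nu>} \<subseteq> {0..1}" using \<nu> by auto
    have emeas: "emeasure (lebesgue_on {0..1}) {0..1 / \<nu>} = ennreal (1 / \<nu>)"
      using \<nu> sub by (subst emeasure_restrict_space) auto
    have sets: "{0..1 / \<nu>} \<in> sets (lebesgue_on {0..1})"
      using sub by (subst sets_restrict_space_iff) auto
    have ind: "has_bochner_integral (lebesgue_on {0..1}) (indicator {0..1 / \<nu>} :: real \<Rightarrow> real) (1 / \<nu>)"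
      using has_bochner_integral_real_indicator[OF sets] emeas \<nu> by (simp add: measure_def)
    note ind' = has_bochner_integral_mult_right[OF ind, of "c * \<nu> * I"]
    have "c * I = (LINT x|lebesgue_on {0..1}. c * \<nu> * I * indicator {0..1 / \<nu>} x)"
      using has_bochner_integral_integral_eq[OF ind'] \<nu> by simp
    also have "\<dots> \<le> (LINT x|lebesgue_on {0..1}. h \<nu> x)"
    proof (rule integral_mono[OF integrable.intros[OF ind'] h_int[OF order_refl \<nu>]])
      fix x assume "x \<in> space (lebesgue_on {0..1 :: real})"
      then show "c * \<nu> * I * indicator {0..1 / \<nu>} x \<le> h \<nu> x"
        using c \<nu> bump_profile_nonneg bump_profile_near_0[OF \<nu>, of x]
        by (auto simp: h_def I_def indicator_def)
    qed
    finally show ?thesis .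
  qed
  have escape: "cmod (complex_of_real (LINT x|lebesgue_on {a..1}. h \<nu> x)) \<le> c / a * tail (1 / a / \<nu>)"
    if a: "0 < a" "a \<le> 1" and \<nu>: "1 \<le> \<nu>" for a \<nu>
  proof -
    let ?B = "c / a * tail (1 / a / \<nu>)"
    have h_nonneg: "0 \<le> h \<nu> x" for x using c \<nu> bump_profile_nonneg by (simp add: h_def)
    have h_le: "h \<nu> x \<le> ?B" if "a \<le> x" for x
      using mult_left_mono[OF bump_profile_away_from_0[OF \<nu> a(1) that], of c] c
      by (simp add: h_def mult.assoc)
    have B: "0 \<le> ?B" using h_nonneg[of a] h_le[of a] by simp
    have emeas: "emeasure (lebesgue_on {a..1}) {a..1} = ennreal (1 - a)"
      using a by (subst emeasure_restrict_space) auto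
    have const: "integrable (lebesgue_on {a..1}) (\<lambda>x. ?B)"
      by (rule finite_measure.integrable_const, rule finite_measureI) (use emeas in simp)
    have "(LINT x|lebesgue_on {a..1}. h \<nu> x) \<le> (LINT x|lebesgue_on {a..1}. ?B)"
      using h_le a by (intro integral_mono[OF h_int const]) (auto simp: \<nu>)
    also have "\<dots> = (1 - a) * ?B" using emeas a by (simp add: measure_def)
    also have "\<dots> \<le> ?B" using mult_right_mono[OF _ B, of "1 - a" 1] a by simp
    finally have "(LINT x|lebesgue_on {a..1}. h \<nu> x) \<le> ?B" .
    moreover have "0 \<le> (LINT x|lebesgue_on {a..1}. h \<nu> x)"
      using h_nonneg by (intro integral_nonneg_AE AE_I2)
    ultimately show ?thesis by simp
  qed
  show ?thesis
  proof (rule not_weakly_compact_if_mass_escapes[where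
      \<phi> = "\<lambda>k. interval_functional (1 / real (Suc k))" and \<phi>\<^sub>0 = "interval_functional 0" and
      u = "\<lambda>n. L1_class \<omega>1 (bump c (real (Suc n)))" and c = "c * I"])
    show "bounded_operator (L1 \<omega>2) complex_space (interval_functional (1 / real (Suc k)))" for k
      by (rule w2.interval_functional_bounded) simp
    show "bounded_operator (L1 \<omega>2) complex_space (interval_functional 0)"
      by (rule w2.interval_functional_bounded) simp
    show "0 < c * I" using c I by simp
    show "c * I \<le> Re (interval_functional 0 (hardy_cesaro_op \<psi> \<omega>2 (L1_class \<omega>1 (bump c (real (Suc n))))))" for n
      using mass[of "real (Suc n)"] by (subst U) auto
    show "(\<lambda>n. interval_functional (1 / real (Suc k))
        (hardy_cesaro_op \<psi> \<omega>2 (L1_class \<omega>1 (bump c (real (Suc n)))))) \<longlonglongrightarrow> 0" for k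
    proof (rule Lim_null_comparison)
      let ?a = "1 / real (Suc k)"
      show "(\<lambda>n. c / ?a * tail (1 / ?a / real (Suc n))) \<longlonglongrightarrow> 0"
        using tendsto_mult[OF tendsto_const[of "c / ?a"] tail_tendsto_0[of "1 / ?a"]]
        by (simp only: mult_zero_right)
      show "\<forall>\<^sub>F n in sequentially. norm (interval_functional ?a
          (hardy_cesaro_op \<psi> \<omega>2 (L1_class \<omega>1 (bump c (real (Suc n))))))
          \<le> c / ?a * tail (1 / ?a / real (Suc n))"
      proof (intro always_eventually allI)
        fix n
        have "0 < ?a" "?a \<le> 1" "1 \<le> real (Suc n)" by auto
        then show "norm (interval_functional ?a
          (hardy_cesaro_op \<psi> \<omega>2 (L1_class \<omega>1 (bump c (real (Suc n))))))
          \<le> c / ?a * tail (1 / ?a / real (Suc n))"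
          using escape[of ?a "real (Suc n)"] by (simp only: U less_imp_le)
      qed
    qed
  qed (use w2.interval_functional_tendsto bump_ball in auto)
qed

end

section \<open>Boundedness without weak compactness\<close>

theorem proposition4p1:
  fixes \<psi> \<omega>1 \<omega>2 :: "real \<Rightarrow> real"
  assumes psi_meas: "\<psi> \<in> borel_measurable (lebesgue_on {0..1})"
    and psi_nonneg: "\<And>t. t \<in> {0..1} \<Longrightarrow> 0 \<le> \<psi> t"
    and w1_cont: "continuous_on {0..} \<omega>1"
    and w1_pos: "\<And>x. 0 \<le> x \<Longrightarrow> 0 < \<omega>1 x"
    and w2_cont: "continuous_on {0..} \<omega>2"
    and w2_pos: "\<And>x. 0 \<le> x \<Longrightarrow> 0 < \<omega>2 x"
    and bound: "\<exists>C::real. \<forall>s\<ge>0.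
      (\<integral>\<^sup>+t. ennreal (\<omega>2 (s / t) * (\<psi> t / t)) \<partial>lebesgue_on {0..1}) \<le> ennreal (C * \<omega>1 s)"
    and psi_nonzero: "\<not> (AE t in lebesgue_on {0..1}. \<psi> t = 0)"
  shows "bounded_operator (L1 \<omega>1) (L1 \<omega>2) (hardy_cesaro_op \<psi> \<omega>2) \<and>
         \<not> weakly_compact_operator (L1 \<omega>1) (L1 \<omega>2) (hardy_cesaro_op \<psi> \<omega>2)"
proof -
  obtain C :: real where C: "\<And>s. 0 \<le> s \<Longrightarrow>
      (\<integral>\<^sup>+t. ennreal (\<omega>2 (s / t) * (\<psi> t / t)) \<partial>lebesgue_on {0..1}) \<le> ennreal (C * \<omega>1 s)"
    using bound by blast
  \<comment> \<open>For negative \<open>C\<close> the right-hand side of the bound is zero by truncation, so that the bound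
    persists with zero in place of \<open>C\<close>.\<close>
  interpret hardy_cesaro_bound \<omega>1 \<omega>2 \<psi> "max C 0"
  proof unfold_locales
    fix s :: real assume s: "0 \<le> s"
    have "ennreal (C * \<omega>1 s) \<le> ennreal (max C 0 * \<omega>1 s)"
      using w1_pos[OF s] by (intro ennreal_leI mult_right_mono) auto
    with C[OF s] show "(\<integral>\<^sup>+t. ennreal (\<omega>2 (s / t) * (\<psi> t / t)) \<partial>lebesgue_on {0..1})
        \<le> ennreal (max C 0 * \<omega>1 s)"
      by (rule order_trans)
  qed (use assms in auto)
  show ?thesis
    using hardy_cesaro_bounded_operator hardy_cesaro_not_weakly_compact[OF psi_nonzero] by blast
qed

end
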